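(* Every existentially closed co-Brouwerian semilattice $L$ satisfies the Splitting Axiom: for all $a,b_1,b_2\in L$ with $b_1\vee b_2\ll a\neq 0$ there exist $a_1,a_2\in L$, both different from $0$, such that $a-a_1=a_2\ge b_2$, $a-a_2=a_1\ge b_1$, $b_2-a_1=b_2-b_1$ and $b_1-a_2=b_1-b_2$.
   Context: A co-Brouwerian semilattice (CBS) is a poset with least element $0$, binary joins $\vee$ and a difference $-$ characterized by $a-b\le c$ iff $a\le b\vee c$. $a\ll b$ means $a\le b$ and $b-a=b$. A CBS $L$ is existentially closed if for every CBS $B\supseteq L$ (superstructure in signature $(0,\vee,-)$), every existential sentence with parameters in $L$ true in $B$ is true in $L$. *)

theory Defs
  imports "HOL-Algebra.Lattice"
begin

section \<open>Co-Brouwerian semilattices\<close>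

text \<open>Zero and join are \<^const>\<open>bottom\<close> and \<^const>\<open>join\<close>, which HOL-Algebra derives from the
  order; only the difference is a field of its own.\<close>

record 'a cbs_struct = "'a gorder" +
  diff :: "['a, 'a] \<Rightarrow> 'a" (infixl \<open>\<ominus>\<index>\<close> 65)

locale co_brouwerian_semilattice = upper_semilattice L + weak_partial_order_bottom L
  for L :: "'a cbs_struct" (structure) +
  assumes diff_closed [simp, intro]:
    "\<lbrakk>a \<in> carrier L; b \<in> carrier L\<rbrakk> \<Longrightarrow> a \<ominus> b \<in> carrier L"
  and diff_le_iff:
    "\<lbrakk>a \<in> carrier L; b \<in> carrier L; c \<in> carrier L\<rbrakk> \<Longrightarrow> a \<ominus> b \<sqsubseteq> c \<longleftrightarrow> a \<sqsubseteq> b \<squnion> c"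

definition well_below :: "'a cbs_struct \<Rightarrow> 'a \<Rightarrow> 'a \<Rightarrow> bool" (infixl \<open>\<lless>\<index>\<close> 50)
  where "a \<lless>\<^bsub>L\<^esub> b \<longleftrightarrow> a \<sqsubseteq>\<^bsub>L\<^esub> b \<and> b \<ominus>\<^bsub>L\<^esub> a = b"

definition cbs_embedding :: "'a cbs_struct \<Rightarrow> 'b cbs_struct \<Rightarrow> ('a \<Rightarrow> 'b) \<Rightarrow> bool"
  where "cbs_embedding L B h \<longleftrightarrow>
    h ` carrier L \<subseteq> carrier B \<and> inj_on h (carrier L) \<and>
    h \<bottom>\<^bsub>L\<^esub> = \<bottom>\<^bsub>B\<^esub> \<and>
    (\<forall>x\<in>carrier L. \<forall>y\<in>carrier L.
       h (x \<squnion>\<^bsub>L\<^esub> y) = h x \<squnion>\<^bsub>B\<^esub> h y \<and> h (x \<ominus>\<^bsub>L\<^esub> y) = h x \<ominus>\<^bsub>B\<^esub> h y)"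


section \<open>Existential sentences with parameters\<close>

datatype (trm_params: 'a) trm =
    Param 'a
  | Var nat
  | Zero
  | Join "'a trm" "'a trm"
  | Diff "'a trm" "'a trm"

datatype (qf_params: 'a) qf =
    Eq "'a trm" "'a trm"
  | Neg "'a qf"
  | Conj "'a qf" "'a qf"
  | Disj "'a qf" "'a qf"

text \<open>The map \<open>h\<close> interprets the parameters, \<open>\<sigma>\<close> assigns values to the variables.\<close>

primrec trm_val :: "'b cbs_struct \<Rightarrow> ('a \<Rightarrow> 'b) \<Rightarrow> (nat \<Rightarrow> 'b) \<Rightarrow> 'a trm \<Rightarrow> 'b" where
  "trm_val B h \<sigma> (Param a) = h a"
| "trm_val B h \<sigma> (Var i) = \<sigma> i"
| "trm_val B h \<sigma> Zero = \<bottom>\<^bsub>B\<^esub>"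
| "trm_val B h \<sigma> (Join s t) = trm_val B h \<sigma> s \<squnion>\<^bsub>B\<^esub> trm_val B h \<sigma> t"
| "trm_val B h \<sigma> (Diff s t) = trm_val B h \<sigma> s \<ominus>\<^bsub>B\<^esub> trm_val B h \<sigma> t"

primrec qf_sat :: "'b cbs_struct \<Rightarrow> ('a \<Rightarrow> 'b) \<Rightarrow> (nat \<Rightarrow> 'b) \<Rightarrow> 'a qf \<Rightarrow> bool" where
  "qf_sat B h \<sigma> (Eq s t) \<longleftrightarrow> trm_val B h \<sigma> s = trm_val B h \<sigma> t"
| "qf_sat B h \<sigma> (Neg p) \<longleftrightarrow> \<not> qf_sat B h \<sigma> p"
| "qf_sat B h \<sigma> (Conj p q) \<longleftrightarrow> qf_sat B h \<sigma> p \<and> qf_sat B h \<sigma> q"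
| "qf_sat B h \<sigma> (Disj p q) \<longleftrightarrow> qf_sat B h \<sigma> p \<or> qf_sat B h \<sigma> q"

text \<open>A quantifier-free formula stands for its existential closure: all its (finitely many)
  variables are bound by an existential quantifier over the carrier.\<close>

definition ex_true :: "'b cbs_struct \<Rightarrow> ('a \<Rightarrow> 'b) \<Rightarrow> 'a qf \<Rightarrow> bool"
  where "ex_true B h p \<longleftrightarrow> (\<exists>\<sigma>. range \<sigma> \<subseteq> carrier B \<and> qf_sat B h \<sigma> p)"


section \<open>Existentially closed co-Brouwerian semilattices\<close>

text \<open>Superstructures of \<open>L\<close> are taken up to isomorphism, as embeddings of \<open>L\<close>. HOL cannot
  quantify over the type of \<open>B\<close>, so the carrier of \<open>B\<close> is a subset of the type of terms with
  parameters. This is no restriction, as the lemma \<open>existentially_closedD\<close> below shows: a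
  superstructure on any type may be replaced by the one generated by \<open>L\<close> and the witnesses of the
  sentence, whose elements are values of terms.\<close>

definition existentially_closed :: "'a cbs_struct \<Rightarrow> bool"
  where "existentially_closed L \<longleftrightarrow>
    (\<forall>(B :: 'a trm cbs_struct) h p.
       co_brouwerian_semilattice B \<longrightarrow> cbs_embedding L B h \<longrightarrow> qf_params p \<subseteq> carrier L \<longrightarrow>
       ex_true B h p \<longrightarrow> ex_true L id p)"

lemma least_imp_bottom:
  assumes "partial_order L" "least L z (carrier L)"
  shows "\<bottom>\<^bsub>L\<^esub> = z"
  unfolding bottom_def using assms partial_order.least_unique by (metis someI_ex)

lemma least_imp_join:
  assumes "partial_order L" "least L z (Upper L {x, y})"
  shows "x \<squnion>\<^bsub>L\<^esub> y = z"
  unfolding join_def sup_def using assms partial_order.least_unique by (metis someI_ex)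

lemma existentially_closedD:
  fixes L :: "'a cbs_struct" and B :: "'b cbs_struct"
  assumes ec: "existentially_closed L"
    and L: "co_brouwerian_semilattice L"
    and B: "co_brouwerian_semilattice B"
    and h: "cbs_embedding L B h"
    and p: "qf_params p \<subseteq> carrier L"
    and ex: "ex_true B h p"
  shows "ex_true L id p"
proof -
  interpret L: co_brouwerian_semilattice L by (rule L)
  interpret B: co_brouwerian_semilattice B by (rule B)
  obtain \<sigma> where \<sigma>: "range \<sigma> \<subseteq> carrier B" "qf_sat B h \<sigma> p"
    using ex by (auto simp: ex_true_def)
  define T where "T = {t :: 'a trm. trm_params t \<subseteq> carrier L}"
  define v where "v = trm_val B h \<sigma>"
  define g where "g = inv_into T v"
  have hB: "h x \<in> carrier B" if "x \<in> carrier L" for x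
    using that h by (auto simp: cbs_embedding_def)
  have "trm_params t \<subseteq> carrier L \<Longrightarrow> v t \<in> carrier B" for t
    unfolding v_def by (induction t) (use \<sigma>(1) hB in auto)
  then have vB: "v t \<in> carrier B" if "t \<in> T" for t
    using that by (simp add: T_def)
  have gT: "g x \<in> T" and vg: "v (g x) = x" if "x \<in> v ` T" for x
    using that by (auto simp: g_def inv_into_into f_inv_into_f)
  have Sbot: "\<bottom>\<^bsub>B\<^esub> \<in> v ` T"
    by (rule image_eqI[of _ _ Zero]) (auto simp: T_def v_def)
  have Sjoin: "x \<squnion>\<^bsub>B\<^esub> y \<in> v ` T" if "x \<in> v ` T" "y \<in> v ` T" for x y
  proof -
    from that obtain s t where "s \<in> T" "t \<in> T" "x = v s" "y = v t" by auto
    then show ?thesis by (intro image_eqI[of _ _ "Join s t"]) (auto simp: T_def v_def)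
  qed
  have Sdiff: "x \<ominus>\<^bsub>B\<^esub> y \<in> v ` T" if "x \<in> v ` T" "y \<in> v ` T" for x y
  proof -
    from that obtain s t where "s \<in> T" "t \<in> T" "x = v s" "y = v t" by auto
    then show ?thesis by (intro image_eqI[of _ _ "Diff s t"]) (auto simp: T_def v_def)
  qed
  have Sh: "h x \<in> v ` T" if "x \<in> carrier L" for x
    using that by (intro image_eqI[of _ _ "Param x"]) (auto simp: T_def v_def)
  have S\<sigma>: "\<sigma> i \<in> v ` T" for i
    by (intro image_eqI[of _ _ "Var i"]) (auto simp: T_def v_def)
  define C :: "'a trm cbs_struct" where
    "C = \<lparr>carrier = g ` v ` T, eq = (=), le = (\<lambda>x y. v x \<sqsubseteq>\<^bsub>B\<^esub> v y),
          diff = (\<lambda>x y. g (v x \<ominus>\<^bsub>B\<^esub> v y))\<rparr>"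
  have Csel: "carrier C = g ` v ` T" "eq C = (=)" "x \<sqsubseteq>\<^bsub>C\<^esub> y \<longleftrightarrow> v x \<sqsubseteq>\<^bsub>B\<^esub> v y"
    "x \<ominus>\<^bsub>C\<^esub> y = g (v x \<ominus>\<^bsub>B\<^esub> v y)" for x y
    by (simp_all add: C_def)
  have gC: "g x \<in> carrier C" if "x \<in> v ` T" for x using that by (simp add: Csel)
  have Cv: "v x \<in> v ` T" "g (v x) = x" "v x \<in> carrier B" if "x \<in> carrier C" for x
    using that gT vg vB by (auto simp: Csel)
  have po: "partial_order C"
  proof
    have "x = y" if "x \<sqsubseteq>\<^bsub>C\<^esub> y" "y \<sqsubseteq>\<^bsub>C\<^esub> x" "x \<in> carrier C" "y \<in> carrier C" for x y
    proof -
      from that have "v x = v y" by (simp add: Csel(3) B.le_antisym Cv)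
      with that show ?thesis by (metis Cv(2))
    qed
    then show "x .=\<^bsub>C\<^esub> y" if "x \<sqsubseteq>\<^bsub>C\<^esub> y" "y \<sqsubseteq>\<^bsub>C\<^esub> x" "x \<in> carrier C" "y \<in> carrier C" for x y
      using that by (simp add: Csel(2))
    show "x \<sqsubseteq>\<^bsub>C\<^esub> z" if "x \<sqsubseteq>\<^bsub>C\<^esub> y" "y \<sqsubseteq>\<^bsub>C\<^esub> z" "x \<in> carrier C" "y \<in> carrier C" "z \<in> carrier C"
      for x y z
      using that B.le_trans unfolding Csel(3) by (meson Cv(3))
  qed (use Cv in \<open>auto simp: Csel(2,3)\<close>)
  have lbot: "least C (g \<bottom>\<^bsub>B\<^esub>) (carrier C)"
    unfolding least_def using Sbot by (auto simp: gC Cv vg Csel(3))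
  have ljoin: "least C (g (v x \<squnion>\<^bsub>B\<^esub> v y)) (Upper C {x, y})"
    if "x \<in> carrier C" "y \<in> carrier C" for x y
    unfolding least_def Upper_def using that Sjoin
    by (auto simp: gC Cv vg Csel(3) B.join_left B.join_right intro!: B.join_le)
  have botC: "\<bottom>\<^bsub>C\<^esub> = g \<bottom>\<^bsub>B\<^esub>" by (rule least_imp_bottom[OF po lbot])
  have joinC: "x \<squnion>\<^bsub>C\<^esub> y = g (v x \<squnion>\<^bsub>B\<^esub> v y)" if "x \<in> carrier C" "y \<in> carrier C" for x y
    by (rule least_imp_join[OF po ljoin[OF that]])
  have C: "co_brouwerian_semilattice C"
  proof -
    interpret C: partial_order C by (rule po)
    show ?thesis
      by unfold_locales
        (use ljoin lbot Sjoin Sdiff Cv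
          in \<open>auto simp: joinC vg gC Csel(3,4) B.diff_le_iff\<close>)
  qed
  have inj: "g x = g y \<longleftrightarrow> x = y" if "x \<in> v ` T" "y \<in> v ` T" for x y
    using that by (metis vg)
  have emb: "cbs_embedding L C (g \<circ> h)"
    using h Sh by (auto simp: cbs_embedding_def inj_on_def botC joinC Csel(4) vg gC inj)
  have val: "trm_val C (g \<circ> h) (g \<circ> \<sigma>) t = g (v t)" if "t \<in> T" for t
    using that
  proof (induction t)
    case (Join s t)
    then have "s \<in> T" "t \<in> T" by (auto simp: T_def)
    with Join show ?case by (simp add: joinC gC vg) (simp add: v_def)
  next
    case (Diff s t)
    then have "s \<in> T" "t \<in> T" by (auto simp: T_def)
    with Diff show ?case by (simp add: Csel(4) vg) (simp add: v_def)
  qed (auto simp: v_def botC)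
  have "qf_params q \<subseteq> carrier L \<Longrightarrow> qf_sat C (g \<circ> h) (g \<circ> \<sigma>) q \<longleftrightarrow> qf_sat B h \<sigma> q" for q
  proof (induction q)
    case (Eq s t)
    then have "s \<in> T" "t \<in> T" by (auto simp: T_def)
    then show ?case by (simp only: qf_sat.simps val) (simp add: inj, simp add: v_def)
  qed auto
  with p \<sigma>(2) have "qf_sat C (g \<circ> h) (g \<circ> \<sigma>) p" by blast
  moreover have "range (g \<circ> \<sigma>) \<subseteq> carrier C" using S\<sigma> gC by auto
  ultimately have "ex_true C (g \<circ> h) p" unfolding ex_true_def by blast
  with ec C emb p show ?thesis unfolding existentially_closed_def by blast
qed

end

(* By existential closedness it suffices to split a in some extension of L.  Ordering L by its own
   order, x |-> {c. ~ x <= c} embeds L into the downsets of L, where the difference of X and Y is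
   the downset generated by the set difference.  Now double every point of L, and among the points
   below the k-th copy of a point that lies in a but not in b1 \/ b2 keep only the k-th copies of
   such points and the points of b_k.  The projection to L is monotone and lifts upward steps, so L
   still embeds into the downsets of the new preorder, and there a is the union of the two copies
   of a - (b1 \/ b2), the k-th together with b_k.  Both are nonempty and generate what is left of
   a after removing the other because b1 \/ b2 << a. *)
theory Submission
  imports Defs
begin

text \<open>For a preorder \<open>R\<close> on \<open>P\<close>, this is the co-Heyting algebra of
  downsets; the difference is the least downset that together with \<open>Y\<close> covers
  \<open>X\<close>.\<close>

definition downset_algebra :: "'p set \<Rightarrow> ('p \<Rightarrow> 'p \<Rightarrow> bool) \<Rightarrow> 'p set cbs_struct" where
  "downset_algebra P R = \<lparr>carrier = {X. X \<subseteq> P \<and> (\<forall>p\<in>P. \<forall>q\<in>X. R p q \<longrightarrow> p \<in> X)}, eq = (=),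
     le = (\<subseteq>), diff = (\<lambda>X Y. {p \<in> P. \<exists>q\<in>X - Y. R p q})\<rparr>"

lemma downset_algebra_simps:
  "carrier (downset_algebra P R) = {X. X \<subseteq> P \<and> (\<forall>p\<in>P. \<forall>q\<in>X. R p q \<longrightarrow> p \<in> X)}"
  "eq (downset_algebra P R) = (=)"
  "le (downset_algebra P R) = (\<subseteq>)"
  "X \<ominus>\<^bsub>downset_algebra P R\<^esub> Y = {p \<in> P. \<exists>q\<in>X - Y. R p q}"
  by (simp_all add: downset_algebra_def)

lemma partial_order_downset_algebra: "partial_order (downset_algebra P R)"
  by unfold_locales (auto simp: downset_algebra_simps)

lemma least_downset_algebra:
  "least (downset_algebra P R) {} (carrier (downset_algebra P R))"
  by (auto simp: least_def downset_algebra_simps)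

lemma bottom_downset_algebra: "\<bottom>\<^bsub>downset_algebra P R\<^esub> = {}"
  by (rule least_imp_bottom[OF partial_order_downset_algebra least_downset_algebra])

lemma least_Upper_downset_algebra:
  assumes "X \<in> carrier (downset_algebra P R)" "Y \<in> carrier (downset_algebra P R)"
  shows "least (downset_algebra P R) (X \<union> Y) (Upper (downset_algebra P R) {X, Y})"
  using assms by (auto simp: least_def Upper_def downset_algebra_simps)

lemma join_downset_algebra:
  assumes "X \<in> carrier (downset_algebra P R)" "Y \<in> carrier (downset_algebra P R)"
  shows "X \<squnion>\<^bsub>downset_algebra P R\<^esub> Y = X \<union> Y"
  by (rule least_imp_join[OF partial_order_downset_algebra least_Upper_downset_algebra[OF assms]])

text \<open>Transitivity makes the generated set a downset. By reflexivity it contains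
  \<open>X - Y\<close>, so a downset \<open>Z\<close> includes it exactly when
  \<open>X - Y \<subseteq> Z\<close>.\<close>

lemma co_brouwerian_downset_algebra:
  assumes R_refl: "\<And>p. p \<in> P \<Longrightarrow> R p p"
    and R_trans: "\<And>p q r. R p q \<Longrightarrow> R q r \<Longrightarrow> R p r"
  shows "co_brouwerian_semilattice (downset_algebra P R)"
proof -
  let ?D = "downset_algebra P R"
  interpret partial_order ?D by (rule partial_order_downset_algebra)
  show ?thesis
  proof
    show "\<exists>s. least ?D s (Upper ?D {X, Y})" if "X \<in> carrier ?D" "Y \<in> carrier ?D" for X Y
      using least_Upper_downset_algebra[OF that] by blast
    show "\<exists>x. least ?D x (carrier ?D)"
      using least_downset_algebra by blast
    show "X \<ominus>\<^bsub>?D\<^esub> Y \<in> carrier ?D" if "X \<in> carrier ?D" "Y \<in> carrier ?D" for X Y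
      unfolding downset_algebra_simps by (auto intro: R_trans)
    show "X \<ominus>\<^bsub>?D\<^esub> Y \<sqsubseteq>\<^bsub>?D\<^esub> Z \<longleftrightarrow> X \<sqsubseteq>\<^bsub>?D\<^esub> Y \<squnion>\<^bsub>?D\<^esub> Z"
      if "X \<in> carrier ?D" "Y \<in> carrier ?D" "Z \<in> carrier ?D" for X Y Z
    proof -
      have "X \<subseteq> P" and Z: "\<And>p q. p \<in> P \<Longrightarrow> q \<in> Z \<Longrightarrow> R p q \<Longrightarrow> p \<in> Z"
        using that by (auto simp: downset_algebra_simps)
      then have "{p \<in> P. \<exists>q\<in>X - Y. R p q} \<subseteq> Z \<longleftrightarrow> X \<subseteq> Y \<union> Z"
        using R_refl by fast
      then show ?thesis
        by (simp only: join_downset_algebra[OF that(2,3)] downset_algebra_simps)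
    qed
  qed
qed

context co_brouwerian_semilattice
begin

lemma join_le_iff:
  assumes "x \<in> carrier L" "y \<in> carrier L" "c \<in> carrier L"
  shows "x \<squnion> y \<sqsubseteq> c \<longleftrightarrow> x \<sqsubseteq> c \<and> y \<sqsubseteq> c"
  using assms by (meson join_closed join_le join_left join_right le_trans)

lemma join_eq_imp_le:
  assumes "x \<in> carrier L" "y \<in> carrier L" "x \<squnion> y = y"
  shows "x \<sqsubseteq> y"
  using join_left[OF assms(1,2)] assms(3) by simp

text \<open>Here \<open>f\<close> is a surjective bounded morphism onto the order of
  \<open>L\<close>, and each image is the preimage under \<open>f\<close> of a downset of
  \<open>L\<close>. Surjectivity yields injectivity, monotonicity yields downsets, and lifting is
  what preserves the difference.\<close>

lemma embedding_downset_algebra: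
  assumes f: "f ` P = carrier L"
    and mono: "\<And>p q. p \<in> P \<Longrightarrow> q \<in> P \<Longrightarrow> R p q \<Longrightarrow> f p \<sqsubseteq> f q"
    and lift: "\<And>p s. p \<in> P \<Longrightarrow> s \<in> carrier L \<Longrightarrow> f p \<sqsubseteq> s \<Longrightarrow> \<exists>q\<in>P. R p q \<and> f q = s"
  shows "cbs_embedding L (downset_algebra P R) (\<lambda>x. {p \<in> P. \<not> x \<sqsubseteq> f p})"
proof -
  let ?h = "\<lambda>x. {p \<in> P. \<not> x \<sqsubseteq> f p}" and ?D = "downset_algebra P R"
  have fP: "f p \<in> carrier L" if "p \<in> P" for p using that f by auto
  have hD: "?h x \<in> carrier ?D" if "x \<in> carrier L" for x
    unfolding downset_algebra_simps by (auto dest: mono intro: le_trans[OF _ _ that fP fP])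
  have le: "x \<sqsubseteq> y" if x: "x \<in> carrier L" and y: "y \<in> carrier L" and h: "?h x \<subseteq> ?h y" for x y
  proof -
    \<comment> \<open>A point over \<open>y\<close> itself is not in \<open>?h y\<close>, hence not
      in \<open>?h x\<close>.\<close>
    obtain p where "p \<in> P" "f p = y" using f y by (metis imageE)
    with h y show ?thesis by auto
  qed
  have inj: "inj_on ?h (carrier L)"
    by (intro inj_onI le_antisym le) auto
  have bot: "?h \<bottom> = {}" using fP bottom_lower by auto
  have join: "?h (x \<squnion> y) = ?h x \<union> ?h y" if "x \<in> carrier L" "y \<in> carrier L" for x y
    using that fP by (auto simp: join_le_iff)
  have diff: "?h (x \<ominus> y) = ?h x \<ominus>\<^bsub>?D\<^esub> ?h y" if x: "x \<in> carrier L" and y: "y \<in> carrier L" for x y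
  proof -
    have "\<not> x \<ominus> y \<sqsubseteq> f p \<longleftrightarrow> (\<exists>q\<in>?h x - ?h y. R p q)" if p: "p \<in> P" for p
    proof
      assume "\<not> x \<ominus> y \<sqsubseteq> f p"
      then have n: "\<not> x \<sqsubseteq> y \<squnion> f p" using diff_le_iff x y fP p by blast
      \<comment> \<open>The witness has to lie over something above both \<open>y\<close> and
        \<open>f p\<close> but not above \<open>x\<close>; the least candidate
        \<open>y \<squnion> f p\<close> works.\<close>
      obtain q where "q \<in> P" "R p q" "f q = y \<squnion> f p"
        using lift[OF p, of "y \<squnion> f p"] y fP p join_right by auto
      with n y fP p join_left show "\<exists>q\<in>?h x - ?h y. R p q" by (intro bexI[of _ q]) auto
    next
      assume "\<exists>q\<in>?h x - ?h y. R p q"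
      then obtain q where q: "q \<in> P" "\<not> x \<sqsubseteq> f q" "y \<sqsubseteq> f q" "R p q" by blast
      have "y \<squnion> f p \<sqsubseteq> f q" using q y fP p mono by (simp add: join_le_iff)
      then have "\<not> x \<sqsubseteq> y \<squnion> f p" using le_trans[of x "y \<squnion> f p" "f q"] q x y fP p by auto
      then show "\<not> x \<ominus> y \<sqsubseteq> f p" using diff_le_iff x y fP p by blast
    qed
    then show ?thesis unfolding downset_algebra_simps by blast
  qed
  show ?thesis
    unfolding cbs_embedding_def bottom_downset_algebra
    using inj bot hD join diff by (auto simp: join_downset_algebra)
qed

text \<open>The index \<open>k\<close> treats both halves at once: \<open>A True\<close> is to be
  \<open>a1\<close> and \<open>A False\<close> is to be \<open>a2\<close>. The order is expressed by
  a join equation, as the formulas have no order symbol.\<close>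

lemma splitting_extension:
  fixes b :: "bool \<Rightarrow> 'a"
  assumes a: "a \<in> carrier L" and bL: "\<And>k. b k \<in> carrier L"
    and wb: "b True \<squnion> b False \<lless> a" and a0: "a \<noteq> \<bottom>"
  shows "\<exists>(B :: ('a \<times> bool) set cbs_struct) h A.
    co_brouwerian_semilattice B \<and> cbs_embedding L B h \<and>
    (\<forall>k. A k \<in> carrier B \<and> A k \<noteq> \<bottom>\<^bsub>B\<^esub> \<and>
      h a \<ominus>\<^bsub>B\<^esub> A (\<not> k) = A k \<and> h (b k) \<squnion>\<^bsub>B\<^esub> A k = A k \<and>
      h (b k) \<ominus>\<^bsub>B\<^esub> A (\<not> k) = h (b k) \<ominus>\<^bsub>B\<^esub> h (b (\<not> k)))"
proof -
  define bb where "bb = b True \<squnion> b False"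
  have bb: "bb \<in> carrier L" "bb \<sqsubseteq> a" "a \<ominus> bb = a"
    using wb bL by (auto simp: bb_def well_below_def)
  have bb_le: "bb \<sqsubseteq> c \<longleftrightarrow> (\<forall>k. b k \<sqsubseteq> c)" if "c \<in> carrier L" for c
    using that bL by (auto simp: bb_def join_le_iff all_bool_eq)
  define P :: "('a \<times> bool) set" where "P = carrier L \<times> UNIV"
  define h where "h = (\<lambda>x. {p \<in> P. \<not> x \<sqsubseteq> fst p})"
  \<comment> \<open>The points of \<open>L\<close> that lie in the downset of \<open>a\<close> but
    not in that of \<open>bb\<close>; only these are divided between the two copies.\<close>
  define X where "X = {c \<in> carrier L. bb \<sqsubseteq> c \<and> \<not> a \<sqsubseteq> c}"
  define A where "A k = {p \<in> P. \<not> b k \<sqsubseteq> fst p \<or> fst p \<in> X \<and> snd p = k}" for k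
  \<comment> \<open>The largest preorder for which the projection is monotone and each \<open>A k\<close> is a downset.\<close>
  define R where "R = (\<lambda>p q. p \<in> P \<and> q \<in> P \<and> fst p \<sqsubseteq> fst q \<and> (\<forall>k. q \<in> A k \<longrightarrow> p \<in> A k))"
  define B where "B = downset_algebra P R"
  have B: "co_brouwerian_semilattice B"
    unfolding B_def
    by (rule co_brouwerian_downset_algebra) (auto simp: R_def P_def intro: le_trans)
  have ha: "p \<in> h a \<longleftrightarrow> (\<exists>k. p \<in> A k)" for p
  proof -
    have "\<not> a \<sqsubseteq> c" if "c \<in> carrier L" "\<not> b k \<sqsubseteq> c" for c k
      using that bb_le le_trans[OF bb(2)] a bb(1) by blast
    then show ?thesis by (auto simp: h_def A_def P_def X_def bb_le) blast
  qed
  have h: "cbs_embedding L B h"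
    unfolding B_def h_def
  proof (rule embedding_downset_algebra)
    fix p s assume p: "p \<in> P" and s: "s \<in> carrier L" and le: "fst p \<sqsubseteq> s"
    \<comment> \<open>Choice of the copy of \<open>s\<close>: if \<open>p\<close> is in some
      \<open>A j\<close>, take the \<open>j\<close>-th. Otherwise \<open>p\<close> lies over a point
      above \<open>a\<close>, so \<open>s\<close> is above \<open>a\<close> too and neither copy is
      in any \<open>A k\<close>.\<close>
    have "\<exists>j. \<forall>k. (s, j) \<in> A k \<longrightarrow> p \<in> A k"
    proof (cases "\<exists>k. p \<in> A k")
      case True
      then obtain j where "p \<in> A j" by blast
      moreover have "b k \<sqsubseteq> s" if "b k \<sqsubseteq> fst p" for k
        by (rule le_trans[OF that le bL]) (use s p in \<open>auto simp: P_def\<close>)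
      ultimately have "p \<in> A k" if "(s, j) \<in> A k" for k
        using that p by (auto simp: A_def)
      then show ?thesis by blast
    next
      case False
      then have "a \<sqsubseteq> fst p" using ha[of p] p by (simp add: h_def)
      then have "a \<sqsubseteq> s" by (rule le_trans[OF _ le a]) (use s p in \<open>auto simp: P_def\<close>)
      then have "(s, j) \<notin> A k" for j k using ha[of "(s, j)"] by (simp add: h_def)
      then show ?thesis by blast
    qed
    then show "\<exists>q\<in>P. R p q \<and> fst q = s" using p s le by (auto simp: R_def P_def)
  qed (auto simp: P_def R_def)
  have hB: "h x \<in> carrier B" if "x \<in> carrier L" for x
    using h that by (auto simp: cbs_embedding_def)
  have AB: "A k \<in> carrier B" for k
    by (auto simp: B_def downset_algebra_simps R_def) (simp add: A_def)
  \<comment> \<open>The use of \<open>bb \<lless> a\<close>: joining with \<open>bb\<close> moves a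
    point into \<open>X\<close> without bringing it above \<open>a\<close>.\<close>
  have bb_X: "bb \<squnion> c \<in> X" if c: "c \<in> carrier L" and n: "\<not> a \<sqsubseteq> c" for c
  proof -
    have "\<not> a \<sqsubseteq> bb \<squnion> c" using diff_le_iff[OF a bb(1) c] bb(3) n by simp
    then show ?thesis using bb(1) c by (simp add: X_def join_left)
  qed
  have X_not_b: "b k \<sqsubseteq> c" if "c \<in> X" for c k
    using that bb_le by (auto simp: X_def)
  have nz: "A k \<noteq> \<bottom>\<^bsub>B\<^esub>" for k
  proof -
    have "\<not> a \<sqsubseteq> \<bottom>" using a a0 by (meson le_antisym bottom_lower bottom_closed)
    then have "bb \<squnion> \<bottom> \<in> X" by (simp add: bb_X)
    then have "(bb \<squnion> \<bottom>, k) \<in> A k" using bb(1) by (simp add: A_def P_def)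
    then show ?thesis by (auto simp: B_def bottom_downset_algebra)
  qed
  have d: "h a \<ominus>\<^bsub>B\<^esub> A (\<not> k) = A k" for k
  proof
    show "h a \<ominus>\<^bsub>B\<^esub> A (\<not> k) \<subseteq> A k"
    proof
      fix p assume "p \<in> h a \<ominus>\<^bsub>B\<^esub> A (\<not> k)"
      then obtain q where q: "q \<in> h a" "q \<notin> A (\<not> k)" "R p q"
        by (auto simp: B_def downset_algebra_simps)
      then obtain j where j: "q \<in> A j" using ha by blast
      \<comment> \<open>With only two indices, a point of \<open>h a\<close> outside
        \<open>A (\<not> k)\<close> is in \<open>A k\<close>, which is closed under
        \<open>R\<close>.\<close>
      with q(2) have "j \<noteq> (\<not> k)" by blast
      then have "j = k" by simp
      with j q(3) show "p \<in> A k" by (simp add: R_def)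
    qed
    show "A k \<subseteq> h a \<ominus>\<^bsub>B\<^esub> A (\<not> k)"
    proof
      fix p assume p: "p \<in> A k"
      then have pP: "fst p \<in> carrier L" "p \<in> P" and "\<not> a \<sqsubseteq> fst p"
        using ha[of p] by (auto simp: h_def A_def P_def)
      \<comment> \<open>Pushed up into \<open>X\<close> and placed in copy \<open>k\<close>, the
        point lies in \<open>A k\<close> alone, so \<open>R p q\<close> asks no more than
        \<open>p \<in> A k\<close>.\<close>
      define q where "q = (bb \<squnion> fst p, k)"
      have qX: "fst q \<in> X" using bb_X pP \<open>\<not> a \<sqsubseteq> fst p\<close> by (simp add: q_def)
      have qP: "q \<in> P" using pP bb by (simp add: q_def P_def)
      have q: "q \<in> A j \<longleftrightarrow> j = k" for j
        using qX qP X_not_b[OF qX] by (simp add: A_def) (auto simp: q_def)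
      have "R p q"
        using pP qP p bb(1) by (simp add: R_def q) (simp add: q_def join_right)
      moreover have "q \<in> h a - A (\<not> k)"
        by (auto simp: ha q)
      ultimately show "p \<in> h a \<ominus>\<^bsub>B\<^esub> A (\<not> k)"
        using pP(2) by (auto simp: B_def downset_algebra_simps)
    qed
  qed
  have le: "h (b k) \<squnion>\<^bsub>B\<^esub> A k = A k" for k
    using join_downset_algebra[OF hB[OF bL[of k], unfolded B_def] AB[of k, unfolded B_def]]
    by (auto simp: B_def h_def A_def)
  \<comment> \<open>The points that \<open>A (\<not> k)\<close> has beyond
    \<open>h (b (\<not> k))\<close> lie over \<open>X\<close>, hence above \<open>b k\<close> and
    outside \<open>h (b k)\<close>.\<close>
  have "h (b k) - A (\<not> k) = h (b k) - h (b (\<not> k))" for k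
    using X_not_b by (auto simp: h_def A_def)
  then have db: "h (b k) \<ominus>\<^bsub>B\<^esub> A (\<not> k) = h (b k) \<ominus>\<^bsub>B\<^esub> h (b (\<not> k))" for k
    by (simp add: B_def downset_algebra_simps)
  show ?thesis
    by (intro exI[of _ B] exI[of _ h] exI[of _ A] conjI allI B h AB nz d le db)
qed

end

theorem theorem4p2:
  fixes L :: "'a cbs_struct" and a b1 b2 :: 'a
  assumes "co_brouwerian_semilattice L"
    and "existentially_closed L"
    and "a \<in> carrier L" "b1 \<in> carrier L" "b2 \<in> carrier L"
    and "b1 \<squnion>\<^bsub>L\<^esub> b2 \<lless>\<^bsub>L\<^esub> a"
    and "a \<noteq> \<bottom>\<^bsub>L\<^esub>"
  shows "\<exists>a1\<in>carrier L. \<exists>a2\<in>carrier L.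
    a1 \<noteq> \<bottom>\<^bsub>L\<^esub> \<and> a2 \<noteq> \<bottom>\<^bsub>L\<^esub> \<and>
    a \<ominus>\<^bsub>L\<^esub> a1 = a2 \<and> b2 \<sqsubseteq>\<^bsub>L\<^esub> a2 \<and>
    a \<ominus>\<^bsub>L\<^esub> a2 = a1 \<and> b1 \<sqsubseteq>\<^bsub>L\<^esub> a1 \<and>
    b2 \<ominus>\<^bsub>L\<^esub> a1 = b2 \<ominus>\<^bsub>L\<^esub> b1 \<and>
    b1 \<ominus>\<^bsub>L\<^esub> a2 = b1 \<ominus>\<^bsub>L\<^esub> b2"
proof -
  interpret co_brouwerian_semilattice L by (rule assms(1))
  define b where "b k = (if k then b1 else b2)" for k
  have b: "b k \<in> carrier L" "b True \<squnion>\<^bsub>L\<^esub> b False \<lless>\<^bsub>L\<^esub> a" for k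
    using assms(4-6) by (simp_all add: b_def)
  obtain B :: "('a \<times> bool) set cbs_struct" and h A where
    B: "co_brouwerian_semilattice B" "cbs_embedding L B h"
    and A: "\<forall>k. A k \<in> carrier B \<and> A k \<noteq> \<bottom>\<^bsub>B\<^esub> \<and>
      h a \<ominus>\<^bsub>B\<^esub> A (\<not> k) = A k \<and> h (b k) \<squnion>\<^bsub>B\<^esub> A k = A k \<and>
      h (b k) \<ominus>\<^bsub>B\<^esub> A (\<not> k) = h (b k) \<ominus>\<^bsub>B\<^esub> h (b (\<not> k))"
    using splitting_extension[OF assms(3) b assms(7)] by (elim exE conjE)
  define \<phi> where "\<phi> =
    Conj (Conj (Conj (Neg (Eq (Var 0) Zero)) (Neg (Eq (Var 1) Zero)))
      (Conj (Eq (Diff (Param a) (Var 0)) (Var 1)) (Eq (Diff (Param a) (Var 1)) (Var 0))))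
     (Conj (Conj (Eq (Join (Param b2) (Var 1)) (Var 1)) (Eq (Join (Param b1) (Var 0)) (Var 0)))
      (Conj (Eq (Diff (Param b2) (Var 0)) (Diff (Param b2) (Param b1)))
        (Eq (Diff (Param b1) (Var 1)) (Diff (Param b1) (Param b2)))))"
  \<comment> \<open>\<open>Var 0\<close> stands for \<open>a1\<close> and \<open>Var 1\<close> for
    \<open>a2\<close>; all further variables also get \<open>A False\<close>, which keeps the range
    in the carrier.\<close>
  have "qf_sat B h (\<lambda>i. A (i = 0)) \<phi>"
    using A[rule_format, of True] A[rule_format, of False] by (simp add: \<phi>_def b_def)
  moreover have "range (\<lambda>i. A (i = 0)) \<subseteq> carrier B" using A by auto
  ultimately have "ex_true B h \<phi>" unfolding ex_true_def by blast
  moreover have "qf_params \<phi> \<subseteq> carrier L" using assms(3-5) by (simp add: \<phi>_def)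
  \<comment> \<open>The extension consists of sets of pairs rather than terms, hence the transfer
    result for arbitrary types instead of the definition.\<close>
  ultimately have "ex_true L id \<phi>"
    using existentially_closedD[OF assms(2,1) B] by blast
  then obtain \<sigma> where \<sigma>: "range \<sigma> \<subseteq> carrier L" "qf_sat L id \<sigma> \<phi>"
    by (auto simp: ex_true_def)
  then have "\<sigma> 0 \<in> carrier L" "\<sigma> 1 \<in> carrier L" by auto
  with \<sigma>(2) assms(4,5) show ?thesis
    by (intro bexI[of _ "\<sigma> 0"] bexI[of _ "\<sigma> 1"]) (simp_all add: \<phi>_def join_eq_imp_le)
qed

end
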